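(* Let $((\mathfrak g,[\cdot,\cdot]_{\mathfrak g},\phi_{\mathfrak g}),\omega)$ be an involutive symplectic hom-Lie algebra, and let $(\mathfrak g,\star,\phi_{\mathfrak g})$ be the induced hom-left-symmetric algebra, where $\star$ is defined by $\omega(x\star y,\phi_{\mathfrak g}(z))=-\omega(\phi_{\mathfrak g}(y),[x,z]_{\mathfrak g})$ for all $x,y,z\in\mathfrak g$. On the complex of vector spaces $\mathfrak g^*\xrightarrow{\phi_{\mathfrak g}\circ(\omega^\sharp)^{-1}}\mathfrak g$ define $l_2$ by $$l_2(x,y)=[x,y]_{\mathfrak g},\qquad l_2(x,\xi)=-l_2(\xi,x)=\rho^*_{\phi_{\mathfrak g}}(x)\xi,\qquad l_2(\xi,\eta)=0$$ for $x,y\in\mathfrak g$, $\xi,\eta\in\mathfrak g^*$, where $\langle\rho^*_{\phi_{\mathfrak g}}(x)\xi,y\rangle=-\langle\xi,x\star y\rangle$. Then $$\big(\mathfrak g^*\xrightarrow{\phi_{\mathfrak g}\circ(\omega^\sharp)^{-1}}\mathfrak g,\ l_2,\ \phi_0=\phi_{\mathfrak g},\ \phi_1=\phi_{\mathfrak g}^*\big)$$ is a strict hom-Lie 2-algebra.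
   Context: **Hom-Lie algebra.** A triple $(\mathfrak g,[\cdot,\cdot]_{\mathfrak g},\phi_{\mathfrak g})$ of a (real) vector space, a skew-symmetric bilinear bracket and a linear map $\phi_{\mathfrak g}:\mathfrak g\to\mathfrak g$ with $\phi_{\mathfrak g}[u,v]_{\mathfrak g}=[\phi_{\mathfrak g}(u),\phi_{\mathfrak g}(v)]_{\mathfrak g}$ and $[\phi_{\mathfrak g}(u),[v,w]_{\mathfrak g}]_{\mathfrak g}+[\phi_{\mathfrak g}(v),[w,u]_{\mathfrak g}]_{\mathfrak g}+[\phi_{\mathfrak g}(w),[u,v]_{\mathfrak g}]_{\mathfrak g}=0$. It is involutive if $\phi_{\mathfrak g}^2=\mathrm{Id}$. The map $\phi_{\mathfrak g}^*:\mathfrak g^*\to\mathfrak g^*$ is the transpose of $\phi_{\mathfrak g}$. **Symplectic hom-Lie algebra.** A hom-Lie algebra with $\phi_{\mathfrak g}$ invertible and a skew-symmetric bilinear form $\omega\in\wedge^2\mathfrak g^*$ such that: $\omega$ is nondegenerate, i.e. $\omega^\sharp:\mathfrak g\to\mathfrak g^*$, $\langle\omega^\sharp(x),y\rangle=\omega(x,y)$, is invertible; $\omega(\phi_{\mathfrak g}(x),\phi_{\mathfrak g}(y))=\omega(x,y)$; and $\omega(\phi_{\mathfrak g}(x),[y,z]_{\mathfrak g})+\omega(\phi_{\mathfrak g}(y),[z,x]_{\mathfrak g})+\omega(\phi_{\mathfrak g}(z),[x,y]_{\mathfrak g})=0$ for all $x,y,z$. **Hom-left-symmetric algebra.** A triple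 $(V,\star,\phi)$ with $\star$ bilinear, $\phi$ linear, $\phi(x\star y)=\phi(x)\star\phi(y)$ and $\phi(x)\star(y\star z)-(x\star y)\star\phi(z)=\phi(y)\star(x\star z)-(y\star x)\star\phi(z)$. **Strict hom-Lie 2-algebra.** This means a 2-term $HL_\infty$-algebra with $l_3=0$. Explicitly, $(V_1\xrightarrow{d}V_0,l_2,\phi_0,\phi_1)$ consists of a linear map $d:V_1\to V_0$, bilinear maps $l_2:V_i\times V_j\to V_{i+j}$ ($i,j\in\{0,1\}$, $V_2=0$), and linear maps $\phi_0:V_0\to V_0$, $\phi_1:V_1\to V_1$ with $\phi_0\circ d=d\circ\phi_1$, such that for all $x,y,z\in V_0$, $m,n\in V_1$: (a) $l_2(x,y)=-l_2(y,x)$; (b) $l_2(x,m)=-l_2(m,x)$; (c) $l_2(m,n)=0$; (d) $d\,l_2(x,m)=l_2(x,dm)$; (e) $l_2(dm,n)=l_2(m,dn)$; (f) $\phi_0(l_2(x,y))=l_2(\phi_0(x),\phi_0(y))$; (g) $\phi_1(l_2(x,m))=l_2(\phi_0(x),\phi_1(m))$; (h) $l_2(\phi_0(x),l_2(y,z))+l_2(\phi_0(y),l_2(z,x))+l_2(\phi_0(z),l_2(x,y))=0$; (i) $l_2(\phi_0(x),l_2(y,m))+l_2(\phi_0(y),l_2(m,x))+l_2(\phi_1(m),l_2(x,y))=0$. *)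

theory Defs
  imports "HOL-Analysis.Linear_Algebra"
begin

typedef (overloaded) 'a alg_dual = "{f :: 'a::real_vector \<Rightarrow> real. linear f}"
  morphisms pairing Functional
  by (auto intro: module_hom_zero)

setup_lifting type_definition_alg_dual

instantiation alg_dual :: (real_vector) real_vector
begin

lift_definition zero_alg_dual :: "'a alg_dual" is "\<lambda>_. 0"
  by (simp add: module_hom_zero)

lift_definition plus_alg_dual :: "'a alg_dual \<Rightarrow> 'a alg_dual \<Rightarrow> 'a alg_dual"
  is "\<lambda>f g x. f x + g x"
  by (rule linear_compose_add)

lift_definition minus_alg_dual :: "'a alg_dual \<Rightarrow> 'a alg_dual \<Rightarrow> 'a alg_dual"
  is "\<lambda>f g x. f x - g x"
  by (rule linear_compose_sub)

lift_definition uminus_alg_dual :: "'a alg_dual \<Rightarrow> 'a alg_dual"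
  is "\<lambda>f x. - f x"
  by (rule linear_compose_neg)

lift_definition scaleR_alg_dual :: "real \<Rightarrow> 'a alg_dual \<Rightarrow> 'a alg_dual"
  is "\<lambda>c f x. c *\<^sub>R f x"
  by (rule linear_compose_scale_right)

instance
  by standard (transfer; simp add: fun_eq_iff algebra_simps)+

end

lemma linear_pairing: "linear (pairing \<xi>)"
  using pairing by blast

lemma pairing_Functional: "linear f \<Longrightarrow> pairing (Functional f) = f"
  by (simp add: Functional_inverse)

text \<open>The space \<open>V\<^sub>2 = 0\<close> in which the bracket of two elements of degree 1 takes its values.\<close>

typedef zero_space = "{0 :: real}"
  by simp

instantiation zero_space :: real_vector
begin

definition "0 = Abs_zero_space 0"
definition "(x :: zero_space) + y = Abs_zero_space 0"
definition "(x :: zero_space) - y = Abs_zero_space 0"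
definition "- (x :: zero_space) = Abs_zero_space 0"
definition "(c :: real) *\<^sub>R (x :: zero_space) = Abs_zero_space 0"

lemma zero_space_eq: "x = (y :: zero_space)"
  by (metis Rep_zero_space Rep_zero_space_inject singletonD)

instance
  by standard (rule zero_space_eq)+

end

locale hom_lie_algebra =
  fixes br :: "'a::real_vector \<Rightarrow> 'a \<Rightarrow> 'a"
    and \<phi> :: "'a \<Rightarrow> 'a"
  assumes br_bilinear: "bilinear br"
    and \<phi>_linear: "linear \<phi>"
    and br_skew: "br u v = - br v u"
    and \<phi>_br: "\<phi> (br u v) = br (\<phi> u) (\<phi> v)"
    and hom_jacobi: "br (\<phi> u) (br v w) + br (\<phi> v) (br w u) + br (\<phi> w) (br u v) = 0"

definition sharp :: "('a::real_vector \<Rightarrow> 'a \<Rightarrow> real) \<Rightarrow> 'a \<Rightarrow> 'a alg_dual" where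
  "sharp \<omega> x = Functional (\<lambda>y. \<omega> x y)"

locale symplectic_hom_lie_algebra = hom_lie_algebra br \<phi>
  for br :: "'a::real_vector \<Rightarrow> 'a \<Rightarrow> 'a" and \<phi> :: "'a \<Rightarrow> 'a" +
  fixes \<omega> :: "'a \<Rightarrow> 'a \<Rightarrow> real"
  assumes \<phi>_bij: "bij \<phi>"
    and \<omega>_bilinear: "bilinear \<omega>"
    and \<omega>_skew: "\<omega> x y = - \<omega> y x"
    and \<omega>_nondegenerate: "bij (sharp \<omega>)"
    and \<omega>_\<phi>: "\<omega> (\<phi> x) (\<phi> y) = \<omega> x y"
    and \<omega>_closed: "\<omega> (\<phi> x) (br y z) + \<omega> (\<phi> y) (br z x) + \<omega> (\<phi> z) (br x y) = 0"

locale involutive_symplectic_hom_lie_algebra = symplectic_hom_lie_algebra br \<phi> \<omega>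
  for br :: "'a::real_vector \<Rightarrow> 'a \<Rightarrow> 'a" and \<phi> :: "'a \<Rightarrow> 'a" and \<omega> :: "'a \<Rightarrow> 'a \<Rightarrow> real" +
  assumes \<phi>_involutive: "\<phi> \<circ> \<phi> = id"

locale hom_left_symmetric_algebra =
  fixes star :: "'a::real_vector \<Rightarrow> 'a \<Rightarrow> 'a"
    and \<phi> :: "'a \<Rightarrow> 'a"
  assumes star_bilinear: "bilinear star"
    and hls_\<phi>_linear: "linear \<phi>"
    and \<phi>_star: "\<phi> (star x y) = star (\<phi> x) (\<phi> y)"
    and hom_left_symmetric:
      "star (\<phi> x) (star y z) - star (star x y) (\<phi> z) = star (\<phi> y) (star x z) - star (star y x) (\<phi> z)"

text \<open>Existence and uniqueness of the product described here, and the fact that it is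
  hom-left-symmetric, are proved at the end of this theory.\<close>

definition induced_product ::
  "('a::real_vector \<Rightarrow> 'a \<Rightarrow> 'a) \<Rightarrow> ('a \<Rightarrow> 'a) \<Rightarrow> ('a \<Rightarrow> 'a \<Rightarrow> real) \<Rightarrow> 'a \<Rightarrow> 'a \<Rightarrow> 'a" where
  "induced_product br \<phi> \<omega> =
     (THE star. \<forall>x y z. \<omega> (star x y) (\<phi> z) = - \<omega> (\<phi> y) (br x z))"

definition dual_map :: "('a::real_vector \<Rightarrow> 'b::real_vector) \<Rightarrow> 'b alg_dual \<Rightarrow> 'a alg_dual" where
  "dual_map f \<xi> = Functional (\<lambda>x. pairing \<xi> (f x))"

definition rho_star :: "('a::real_vector \<Rightarrow> 'a \<Rightarrow> 'a) \<Rightarrow> 'a \<Rightarrow> 'a alg_dual \<Rightarrow> 'a alg_dual" where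
  "rho_star star x \<xi> = Functional (\<lambda>y. - pairing \<xi> (star x y))"

text \<open>The bracket \<open>l\<^sub>2\<close> is given by its components \<open>l\<^sub>i\<^sub>j : V\<^sub>i \<times> V\<^sub>j \<rightarrow> V\<^sub>i\<^sub>+\<^sub>j\<close>.\<close>

locale strict_hom_lie_2_algebra =
  fixes d :: "'v1::real_vector \<Rightarrow> 'v0::real_vector"
    and l00 :: "'v0 \<Rightarrow> 'v0 \<Rightarrow> 'v0"
    and l01 :: "'v0 \<Rightarrow> 'v1 \<Rightarrow> 'v1"
    and l10 :: "'v1 \<Rightarrow> 'v0 \<Rightarrow> 'v1"
    and l11 :: "'v1 \<Rightarrow> 'v1 \<Rightarrow> zero_space"
    and \<phi>0 :: "'v0 \<Rightarrow> 'v0"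
    and \<phi>1 :: "'v1 \<Rightarrow> 'v1"
  assumes d_linear: "linear d"
    and l00_bilinear: "bilinear l00"
    and l01_bilinear: "bilinear l01"
    and l10_bilinear: "bilinear l10"
    and l11_bilinear: "bilinear l11"
    and \<phi>0_linear: "linear \<phi>0"
    and \<phi>1_linear: "linear \<phi>1"
    and \<phi>_chain_map: "\<phi>0 \<circ> d = d \<circ> \<phi>1"
    and l00_skew: "l00 x y = - l00 y x"
    and l01_skew: "l01 x m = - l10 m x"
    and l11_zero: "l11 m n = 0"
    and d_l01: "d (l01 x m) = l00 x (d m)"
    and l01_d: "l01 (d m) n = l10 m (d n)"
    and \<phi>0_l00: "\<phi>0 (l00 x y) = l00 (\<phi>0 x) (\<phi>0 y)"
    and \<phi>1_l01: "\<phi>1 (l01 x m) = l01 (\<phi>0 x) (\<phi>1 m)"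
    and jacobi_000: "l00 (\<phi>0 x) (l00 y z) + l00 (\<phi>0 y) (l00 z x) + l00 (\<phi>0 z) (l00 x y) = 0"
    and jacobi_001: "l01 (\<phi>0 x) (l01 y m) + l01 (\<phi>0 y) (l10 m x) + l10 (\<phi>1 m) (l00 x y) = 0"

lemma bilinear_linear_right: "bilinear f \<Longrightarrow> linear (f x)"
  by (simp add: bilinear_def)

lemma bilinear_linear_left: "bilinear f \<Longrightarrow> linear (\<lambda>x. f x y)"
  by (simp add: bilinear_def)

lemma pairing_dual_map:
  assumes "linear f"
  shows "pairing (dual_map f \<xi>) x = pairing \<xi> (f x)"
  unfolding dual_map_def
  using linear_compose[OF assms linear_pairing[of \<xi>]] by (simp add: o_def pairing_Functional)

lemma pairing_rho_star:
  assumes "bilinear star"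
  shows "pairing (rho_star star x \<xi>) y = - pairing \<xi> (star x y)"
proof -
  have "linear (\<lambda>y. - pairing \<xi> (star x y))"
    using linear_compose[OF bilinear_linear_right[OF assms, of x] linear_pairing[of \<xi>]]
    by (intro linear_compose_neg) (simp add: o_def)
  then show ?thesis
    by (simp add: rho_star_def pairing_Functional)
qed

context symplectic_hom_lie_algebra
begin

lemma pairing_sharp: "pairing (sharp \<omega> x) y = \<omega> x y"
  using \<omega>_bilinear by (simp add: sharp_def pairing_Functional bilinear_linear_right)

lemma \<omega>_cancel: "(\<And>z. \<omega> u (\<phi> z) = \<omega> v (\<phi> z)) \<Longrightarrow> u = v"
proof -
  assume h: "\<And>z. \<omega> u (\<phi> z) = \<omega> v (\<phi> z)"
  have "\<omega> u y = \<omega> v y" for y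
    using h[of "inv \<phi> y"] \<phi>_bij by (simp add: bij_is_surj surj_f_inv_f)
  then have "pairing (sharp \<omega> u) = pairing (sharp \<omega> v)"
    by (simp add: fun_eq_iff pairing_sharp)
  then show "u = v"
    using \<omega>_nondegenerate by (metis bij_is_inj injD pairing_inject)
qed

lemma induced_product_ex1:
  "\<exists>!star. \<forall>x y z. \<omega> (star x y) (\<phi> z) = - \<omega> (\<phi> y) (br x z)"
proof (rule ex_ex1I)
  have inv\<phi>: "linear (inv \<phi>)"
    by (intro linearI inv_f_eq[OF bij_is_inj[OF \<phi>_bij]])
       (simp_all add: linear_add[OF \<phi>_linear] linear_scale[OF \<phi>_linear]
         surj_f_inv_f[OF bij_is_surj[OF \<phi>_bij]])
  have "\<exists>w. \<forall>z. \<omega> w (\<phi> z) = - \<omega> (\<phi> y) (br x z)" for x y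
  proof -
    let ?f = "\<lambda>z. - \<omega> (\<phi> y) (br x (inv \<phi> z))"
    have "linear ?f"
      using linear_compose[OF linear_compose[OF inv\<phi> bilinear_linear_right[OF br_bilinear, of x]]
        bilinear_linear_right[OF \<omega>_bilinear, of "\<phi> y"]]
      by (intro linear_compose_neg) (simp add: o_def)
    moreover obtain w where "sharp \<omega> w = Functional ?f"
      using \<omega>_nondegenerate by (metis bij_pointE)
    ultimately have "\<omega> w z = ?f z" for z
      by (metis pairing_sharp pairing_Functional)
    then have "\<omega> w (\<phi> z) = - \<omega> (\<phi> y) (br x z)" for z
      using \<phi>_bij by (simp add: bij_is_inj)
    then show ?thesis by blast
  qed
  then have "\<exists>f. \<forall>y z. \<omega> (f y) (\<phi> z) = - \<omega> (\<phi> y) (br x z)" for x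
    by (intro choice) blast
  then show "\<exists>star. \<forall>x y z. \<omega> (star x y) (\<phi> z) = - \<omega> (\<phi> y) (br x z)"
    by (intro choice) blast
next
  fix s t
  assume "\<forall>x y z. \<omega> (s x y) (\<phi> z) = - \<omega> (\<phi> y) (br x z)"
    and "\<forall>x y z. \<omega> (t x y) (\<phi> z) = - \<omega> (\<phi> y) (br x z)"
  then show "s = t"
    by (intro ext \<omega>_cancel) simp
qed

abbreviation star (infixl "\<star>" 70) where
  "star \<equiv> induced_product br \<phi> \<omega>"

lemma induced_product_eq: "\<omega> (x \<star> y) (\<phi> z) = - \<omega> (\<phi> y) (br x z)"
  using theI'[OF induced_product_ex1] unfolding induced_product_def by blast

lemmas \<omega>_linear_rules =
  bilinear_ladd[OF \<omega>_bilinear] bilinear_radd[OF \<omega>_bilinear]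
  bilinear_lmul[OF \<omega>_bilinear] bilinear_rmul[OF \<omega>_bilinear]
  bilinear_lsub[OF \<omega>_bilinear] bilinear_rsub[OF \<omega>_bilinear]
  bilinear_lneg[OF \<omega>_bilinear] bilinear_rneg[OF \<omega>_bilinear]

lemmas br_linear_rules =
  bilinear_ladd[OF br_bilinear] bilinear_radd[OF br_bilinear]
  bilinear_lmul[OF br_bilinear] bilinear_rmul[OF br_bilinear]
  bilinear_lneg[OF br_bilinear] bilinear_rneg[OF br_bilinear]

lemma induced_product_bilinear: "bilinear star"
  unfolding bilinear_def
  by (intro conjI allI linearI; rule \<omega>_cancel)
     (simp_all add: induced_product_eq \<omega>_linear_rules br_linear_rules
       linear_add[OF \<phi>_linear] linear_scale[OF \<phi>_linear])

end

context involutive_symplectic_hom_lie_algebra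
begin

lemma \<phi>_\<phi>: "\<phi> (\<phi> x) = x"
  using \<phi>_involutive by (simp add: fun_eq_iff)

lemma \<phi>_induced_product: "\<phi> (x \<star> y) = \<phi> x \<star> \<phi> y"
proof (rule \<omega>_cancel)
  fix z
  have "\<omega> (\<phi> (x \<star> y)) (\<phi> z) = \<omega> (x \<star> y) (\<phi> (\<phi> z))"
    by (simp add: \<omega>_\<phi> \<phi>_\<phi>)
  also have "\<dots> = - \<omega> (\<phi> y) (br x (\<phi> z))"
    by (rule induced_product_eq)
  also have "\<dots> = - \<omega> (\<phi> (\<phi> y)) (\<phi> (br x (\<phi> z)))"
    by (simp add: \<omega>_\<phi>)
  also have "\<dots> = \<omega> (\<phi> x \<star> \<phi> y) (\<phi> z)"
    by (simp add: \<phi>_br \<phi>_\<phi> induced_product_eq)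
  finally show "\<omega> (\<phi> (x \<star> y)) (\<phi> z) = \<omega> (\<phi> x \<star> \<phi> y) (\<phi> z)" .
qed

lemma induced_product_commutator: "x \<star> y - y \<star> x = br x y"
proof (rule \<omega>_cancel)
  fix z
  have "\<omega> (x \<star> y - y \<star> x) (\<phi> z) = \<omega> (\<phi> y) (br z x) + \<omega> (\<phi> x) (br y z)"
    using br_skew[of x z] by (simp add: \<omega>_linear_rules induced_product_eq)
  also have "\<dots> = - \<omega> (\<phi> z) (br x y)"
    using \<omega>_closed[of x y z] by simp
  also have "\<dots> = \<omega> (br x y) (\<phi> z)"
    using \<omega>_skew[of "br x y" "\<phi> z"] by simp
  finally show "\<omega> (x \<star> y - y \<star> x) (\<phi> z) = \<omega> (br x y) (\<phi> z)" .
qed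

lemma induced_product_twice: "\<omega> (\<phi> x \<star> (y \<star> z)) (\<phi> w) = \<omega> (\<phi> z) (br y (br (\<phi> x) w))"
proof -
  have "\<omega> (\<phi> x \<star> (y \<star> z)) (\<phi> w) = - \<omega> (y \<star> z) (\<phi> (br (\<phi> x) w))"
    by (metis induced_product_eq \<omega>_\<phi> \<phi>_\<phi>)
  then show ?thesis
    by (simp add: induced_product_eq)
qed

theorem induced_product_hom_left_symmetric: "hom_left_symmetric_algebra star \<phi>"
proof (rule hom_left_symmetric_algebra.intro)
  show "\<phi> x \<star> (y \<star> z) - x \<star> y \<star> \<phi> z = \<phi> y \<star> (x \<star> z) - y \<star> x \<star> \<phi> z" for x y z
  proof -
    have "\<phi> x \<star> (y \<star> z) - \<phi> y \<star> (x \<star> z) = br x y \<star> \<phi> z"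
    proof (rule \<omega>_cancel)
      fix w
      have j: "br y (br (\<phi> x) w) - br x (br (\<phi> y) w) = - br (\<phi> (br x y)) (\<phi> w)"
        using hom_jacobi[of "\<phi> x" "\<phi> y" w] br_skew[of "\<phi> w"] br_skew[of w]
        by (simp add: \<phi>_\<phi> \<phi>_br br_linear_rules algebra_simps)
      have "\<omega> (\<phi> x \<star> (y \<star> z) - \<phi> y \<star> (x \<star> z)) (\<phi> w)
          = \<omega> (\<phi> z) (br y (br (\<phi> x) w) - br x (br (\<phi> y) w))"
        by (simp add: \<omega>_linear_rules induced_product_twice)
      also have "\<dots> = - \<omega> (\<phi> z) (\<phi> (br (br x y) w))"
        by (simp add: j \<omega>_linear_rules \<phi>_br)
      also have "\<dots> = \<omega> (br x y \<star> \<phi> z) (\<phi> w)"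
        by (simp add: \<omega>_\<phi> induced_product_eq \<phi>_\<phi>)
      finally show "\<omega> (\<phi> x \<star> (y \<star> z) - \<phi> y \<star> (x \<star> z)) (\<phi> w) = \<omega> (br x y \<star> \<phi> z) (\<phi> w)" .
    qed
    moreover have "br x y \<star> \<phi> z = x \<star> y \<star> \<phi> z - y \<star> x \<star> \<phi> z"
      by (simp flip: induced_product_commutator add: bilinear_lsub[OF induced_product_bilinear])
    ultimately show ?thesis
      by (simp add: algebra_simps)
  qed
qed (rule induced_product_bilinear \<phi>_linear \<phi>_induced_product)+

end

end

(* Every element of the dual is \<omega>\<^sup>\<sharp>(u) for a unique u, and under this identification d becomes \<phi>,
   the transpose of \<phi> becomes \<phi>, and \<rho>\<^sup>*(x) becomes u \<mapsto> \<phi> [x, \<phi> u]. The axioms of a strict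
   hom-Lie 2-algebra then reduce to skew-symmetry, multiplicativity of \<phi> and the hom-Jacobi
   identity on the Lie side. *)

theory Submission
  imports Defs
begin

text \<open>Reduces identities in the dual to evaluation at vectors, where
  \<open>pairing_dual_map\<close>, \<open>pairing_rho_star\<close> and \<open>pairing_sharp\<close>
  compute both sides.\<close>

lemma alg_dual_eqI: "(\<And>x. pairing \<xi> x = pairing \<eta> x) \<Longrightarrow> \<xi> = \<eta>"
  by (simp add: pairing_inject[symmetric] fun_eq_iff)

lemma linear_dual_map:
  assumes "linear f"
  shows "linear (dual_map f)"
  by (intro linearI alg_dual_eqI)
     (simp_all add: pairing_dual_map[OF assms] plus_alg_dual.rep_eq scaleR_alg_dual.rep_eq)

lemma bilinear_rho_star:
  assumes "bilinear star"
  shows "bilinear (rho_star star)"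
  unfolding bilinear_def
  by (intro conjI allI linearI; rule alg_dual_eqI)
     (simp_all add: pairing_rho_star[OF assms] plus_alg_dual.rep_eq scaleR_alg_dual.rep_eq
       bilinear_ladd[OF assms] bilinear_lmul[OF assms]
       linear_add[OF linear_pairing] linear_scale[OF linear_pairing] algebra_simps)

context symplectic_hom_lie_algebra
begin

lemma linear_sharp: "linear (sharp \<omega>)"
  by (intro linearI alg_dual_eqI)
     (simp_all add: pairing_sharp plus_alg_dual.rep_eq scaleR_alg_dual.rep_eq \<omega>_linear_rules)

lemma inv_sharp_sharp: "inv (sharp \<omega>) (sharp \<omega> u) = u"
  using \<omega>_nondegenerate by (simp add: bij_is_inj)

lemma linear_inv_sharp: "linear (inv (sharp \<omega>))"
  by (intro linearI inv_f_eq[OF bij_is_inj[OF \<omega>_nondegenerate]])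
     (simp_all add: linear_add[OF linear_sharp] linear_scale[OF linear_sharp]
       surj_f_inv_f[OF bij_is_surj[OF \<omega>_nondegenerate]])

text \<open>Nondegeneracy as a substitution rule: a covector in an axiom may be traded for a
  vector.\<close>

lemma sharp_cases: obtains u where "\<xi> = sharp \<omega> u"
  using \<omega>_nondegenerate by (metis bij_pointE)

end

context involutive_symplectic_hom_lie_algebra
begin

text \<open>Invariance of \<open>\<omega>\<close> together with \<open>\<phi> (\<phi> x) = x\<close>
  makes \<open>\<phi>\<close> self-adjoint for \<open>\<omega>\<close>: both pairings equal
  \<open>\<omega> (\<phi> u) y\<close>.\<close>

lemma dual_map_sharp: "dual_map \<phi> (sharp \<omega> u) = sharp \<omega> (\<phi> u)"
proof (rule alg_dual_eqI)
  fix y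
  show "pairing (dual_map \<phi> (sharp \<omega> u)) y = pairing (sharp \<omega> (\<phi> u)) y"
    using \<omega>_\<phi>[of u "\<phi> y"] \<omega>_\<phi>[of "\<phi> u" y]
    by (simp add: pairing_dual_map[OF \<phi>_linear] pairing_sharp \<phi>_\<phi>)
qed

text \<open>The defining relation of the induced product moves the bracket onto \<open>u\<close>,
  and self-adjointness of \<open>\<phi>\<close> then frees the argument \<open>y\<close>.\<close>

lemma rho_star_sharp: "rho_star star x (sharp \<omega> u) = sharp \<omega> (\<phi> (br x (\<phi> u)))"
proof (rule alg_dual_eqI)
  fix y
  \<comment> \<open>Skew-symmetry absorbs the sign, and \<open>u\<close> is written as
    \<open>\<phi> (\<phi> u)\<close> because \<open>induced_product_eq\<close> needs a second
    argument of the form \<open>\<phi> z\<close>.\<close>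
  have "pairing (rho_star star x (sharp \<omega> u)) y = \<omega> (x \<star> y) (\<phi> (\<phi> u))"
    using \<omega>_skew[of u] by (simp add: pairing_rho_star[OF induced_product_bilinear] pairing_sharp \<phi>_\<phi>)
  also have "\<dots> = \<omega> (br x (\<phi> u)) (\<phi> y)"
    using \<omega>_skew[of "\<phi> y"] by (simp add: induced_product_eq)
  also have "\<dots> = \<omega> (\<phi> (br x (\<phi> u))) y"
    using \<omega>_\<phi>[of "br x (\<phi> u)" "\<phi> y"] by (simp add: \<phi>_\<phi>)
  finally show "pairing (rho_star star x (sharp \<omega> u)) y = pairing (sharp \<omega> (\<phi> (br x (\<phi> u)))) y"
    by (simp add: pairing_sharp)
qed

lemma strict_hom_lie_2_algebra_sharp:
  "strict_hom_lie_2_algebra (\<phi> \<circ> inv (sharp \<omega>)) br (rho_star star)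
     (\<lambda>\<xi> x. - rho_star star x \<xi>) (\<lambda>\<xi> \<eta>. 0) \<phi> (dual_map \<phi>)"
proof (rule strict_hom_lie_2_algebra.intro)
  note rho = bilinear_rho_star[OF induced_product_bilinear]
  show "linear (\<phi> \<circ> inv (sharp \<omega>))"
    by (rule linear_compose[OF linear_inv_sharp \<phi>_linear])
  show "bilinear br" by (rule br_bilinear)
  show "bilinear (rho_star star)" by (rule rho)
  show "bilinear (\<lambda>\<xi> x. - rho_star star x \<xi>)"
    using rho by (auto simp: bilinear_def intro: linear_compose_neg)
  show "bilinear (\<lambda>(\<xi> :: 'a alg_dual) (\<eta> :: 'a alg_dual). 0 :: zero_space)"
    by (simp add: bilinear_def module_hom_zero)
  show "linear \<phi>" by (rule \<phi>_linear)
  show "linear (dual_map \<phi>)" by (rule linear_dual_map[OF \<phi>_linear])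
  show "\<phi> \<circ> (\<phi> \<circ> inv (sharp \<omega>)) = \<phi> \<circ> inv (sharp \<omega>) \<circ> dual_map \<phi>"
  proof
    fix \<xi>
    obtain u where "\<xi> = sharp \<omega> u" by (rule sharp_cases)
    then show "(\<phi> \<circ> (\<phi> \<circ> inv (sharp \<omega>))) \<xi> = (\<phi> \<circ> inv (sharp \<omega>) \<circ> dual_map \<phi>) \<xi>"
      by (simp add: dual_map_sharp inv_sharp_sharp)
  qed
  fix x y z and m n
  obtain u where m: "m = sharp \<omega> u" by (rule sharp_cases)
  obtain v where n: "n = sharp \<omega> v" by (rule sharp_cases)
  show "br x y = - br y x" by (rule br_skew)
  show "rho_star star x m = - (- rho_star star x m)" by simp
  show "(0 :: zero_space) = 0" ..
  \<comment> \<open>The \<open>\<phi>\<close> in \<open>d\<close> cancels the outer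
    \<open>\<phi>\<close> of \<open>rho_star_sharp\<close>, so both sides become
    \<open>br x (\<phi> u)\<close>.\<close>
  show "(\<phi> \<circ> inv (sharp \<omega>)) (rho_star star x m) = br x ((\<phi> \<circ> inv (sharp \<omega>)) m)"
    by (simp add: m rho_star_sharp inv_sharp_sharp \<phi>_\<phi>)
  \<comment> \<open>The left side is
    \<open>sharp \<omega> (\<phi> (br (\<phi> u) (\<phi> v)))\<close>, which changes sign when
    \<open>u\<close> and \<open>v\<close> are swapped.\<close>
  show "rho_star star ((\<phi> \<circ> inv (sharp \<omega>)) m) n = - rho_star star ((\<phi> \<circ> inv (sharp \<omega>)) n) m"
    using br_skew[of "\<phi> u" "\<phi> v"]
    by (simp add: m n rho_star_sharp inv_sharp_sharp linear_neg[OF \<phi>_linear] linear_neg[OF linear_sharp])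
  show "\<phi> (br x y) = br (\<phi> x) (\<phi> y)" by (rule \<phi>_br)
  show "dual_map \<phi> (rho_star star x m) = rho_star star (\<phi> x) (dual_map \<phi> m)"
    by (simp add: m rho_star_sharp dual_map_sharp \<phi>_br)
  show "br (\<phi> x) (br y z) + br (\<phi> y) (br z x) + br (\<phi> z) (br x y) = 0" by (rule hom_jacobi)
  \<comment> \<open>Hom-Jacobi for \<open>x\<close>, \<open>y\<close> and \<open>\<phi> u\<close>,
    with \<open>\<phi> (\<phi> u)\<close> collapsed to \<open>u\<close>. Its three terms become
    those of the mixed Jacobi identity once \<open>sharp \<omega>\<close> after
    \<open>\<phi>\<close> is applied.\<close>
  have "br (\<phi> x) (br y (\<phi> u)) - br (\<phi> y) (br x (\<phi> u)) - br (br x y) u = 0"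
    using hom_jacobi[of x y "\<phi> u"] br_skew[of x "\<phi> u"] br_skew[of "br x y" u]
    by (simp add: \<phi>_\<phi> br_linear_rules)
  then have "sharp \<omega> (\<phi> (br (\<phi> x) (br y (\<phi> u)) - br (\<phi> y) (br x (\<phi> u)) - br (br x y) u)) = 0"
    by (simp add: linear_0[OF \<phi>_linear] linear_0[OF linear_sharp])
  then show "rho_star star (\<phi> x) (rho_star star y m) + rho_star star (\<phi> y) (- rho_star star x m)
      + - rho_star star (br x y) (dual_map \<phi> m) = 0"
    by (simp add: m rho_star_sharp dual_map_sharp \<phi>_\<phi> bilinear_rneg[OF rho]
      linear_diff[OF \<phi>_linear] linear_diff[OF linear_sharp])
qed

end

theorem theorem5p11:
  fixes br :: "'a::real_vector \<Rightarrow> 'a \<Rightarrow> 'a"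
    and \<phi> :: "'a \<Rightarrow> 'a"
    and \<omega> :: "'a \<Rightarrow> 'a \<Rightarrow> real"
  assumes "involutive_symplectic_hom_lie_algebra br \<phi> \<omega>"
  shows "strict_hom_lie_2_algebra
    (\<phi> \<circ> inv (sharp \<omega>))
    br
    (\<lambda>x \<xi>. rho_star (induced_product br \<phi> \<omega>) x \<xi>)
    (\<lambda>\<xi> x. - rho_star (induced_product br \<phi> \<omega>) x \<xi>)
    (\<lambda>\<xi> \<eta>. 0)
    \<phi>
    (dual_map \<phi>)"
  using assms by (rule involutive_symplectic_hom_lie_algebra.strict_hom_lie_2_algebra_sharp)

end
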